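(* There is an absolute constant $c>0$ such that for every integer $n\ge 1$ there exists an instance of the two-sided assortment problem with $n$ customers, with all demand functions monotone and submodular, such that $\mathrm{OPT}_{FS}>0$ and $$\mathrm{OPT}_{OS}\ \ge\ c\,n\cdot \mathrm{OPT}_{FS}.$$
   Context: Instance: finite disjoint nonempty sets $\mathcal C$ (customers, $|\mathcal C|=n$) and $\mathcal S$ (suppliers, $|\mathcal S|=m$); agents $\mathcal A=\mathcal C\cup\mathcal S$. For $a\in\mathcal A$ let $N_a$ be the opposite side. Each agent $a$ has a choice model $\phi_a:(N_a\cup\{0\})\times 2^{N_a}\to[0,1]$ ($0$ is the outside option) with $\sum_{b\in B\cup\{0\}}\phi_a(b,B)=1$ and $\phi_a(b,B)=0$ for $b\notin B\cup\{0\}$. Agents may have different choice models. Demand function: $f_a(B)=\sum_{b\in B}\phi_a(b,B)$ for $B\subseteq N_a$. Standing assumption: every $f_a$ is a monotone submodular set function. Policy: proceeds in steps; in each step, based on all choices observed so far (and possibly its own randomness), it selects a set of not-yet-processed agents and shows each selected agent $a$ an assortment $B_a\subseteq N_a$ (any subset allowed); each selected agent independently and irrevocably chooses $b\in B_a\cup\{0\}$ with probability $\phi_a(b,B_a)$, and these choices are observed. It stops when every agent has been processed exactly once. A customer $i$ and supplier $j$ match if $i$ chose $j$ and $j$ chose $i$. $\mathsf M_\pi$ is the (random) number of matches under policy $\pi$. $\mathrm{OPT}_{FS}$ is the maximum of $\mathbb E[\mathsf M_\pi]$ over fully static policies, i.e. those that process all agents of $\mathcal A$ simultaneously in a single step.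 $\mathrm{OPT}_{OS}$ is the maximum of $\mathbb E[\mathsf M_\pi]$ over one-sided static policies, i.e. policies that either process all customers simultaneously first, observe their choices, and then process all suppliers, or process all suppliers simultaneously first, observe their choices, and then process all customers (the side going first is fixed, not randomized). *)

theory Defs
  imports "HOL-Probability.Product_PMF"
begin

text \<open>
  \<^term>\<open>choice M a B\<close> is the law of the selection of agent \<^term>\<open>a\<close> from the assortment
  \<^term>\<open>B\<close>. The outside option is \<^term>\<open>None\<close>, and the choice probability
  \<open>\<phi>\<^sub>a(b, B)\<close> is \<^term>\<open>pmf (choice M a B) (Some b)\<close>.
\<close>

record 'a market =
  customers :: "'a set"
  suppliers :: "'a set"
  choice :: "'a \<Rightarrow> 'a set \<Rightarrow> 'a option pmf"

definition agents :: "'a market \<Rightarrow> 'a set" where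
  "agents M = customers M \<union> suppliers M"

definition opposite :: "'a market \<Rightarrow> 'a \<Rightarrow> 'a set" where
  "opposite M a = (if a \<in> customers M then suppliers M else customers M)"

definition market :: "'a market \<Rightarrow> bool" where
  "market M \<longleftrightarrow>
     finite (customers M) \<and> customers M \<noteq> {} \<and>
     finite (suppliers M) \<and> suppliers M \<noteq> {} \<and>
     customers M \<inter> suppliers M = {} \<and>
     (\<forall>a\<in>agents M. \<forall>B. B \<subseteq> opposite M a \<longrightarrow>
        set_pmf (choice M a B) \<subseteq> insert None (Some ` B))"

definition demand :: "'a market \<Rightarrow> 'a \<Rightarrow> 'a set \<Rightarrow> real" where
  "demand M a B = (\<Sum>b\<in>B. pmf (choice M a B) (Some b))"

definition submodular_on :: "'a set \<Rightarrow> ('a set \<Rightarrow> real) \<Rightarrow> bool" where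
  "submodular_on V f \<longleftrightarrow>
     (\<forall>X Y. X \<subseteq> V \<longrightarrow> Y \<subseteq> V \<longrightarrow> f (X \<union> Y) + f (X \<inter> Y) \<le> f X + f Y)"

definition monotone_submodular_demands :: "'a market \<Rightarrow> bool" where
  "monotone_submodular_demands M \<longleftrightarrow>
     (\<forall>a\<in>agents M. mono_on (Pow (opposite M a)) (demand M a) \<and>
                    submodular_on (opposite M a) (demand M a))"

text \<open>
  An offer is what a policy does in one step: its domain is the set of selected agents, each
  mapped to the assortment it is shown. A round records, for each agent processed in one step,
  the assortment shown and the option chosen. A history lists the completed rounds, oldest first.

  A policy draws its next offer from a distribution depending on the history. Histories contain
  the assortments shown, so the policy's own randomness may be correlated across steps. Only
  finitely many offers are admissible, so discrete distributions suffice.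
\<close>

type_synonym 'a offer = "'a \<rightharpoonup> 'a set"
type_synonym 'a round = "'a \<rightharpoonup> 'a set \<times> 'a option"
type_synonym 'a history = "'a round list"
type_synonym 'a policy = "'a history \<Rightarrow> 'a offer pmf"

definition processed :: "'a history \<Rightarrow> 'a set" where
  "processed h = (\<Union>r\<in>set h. dom r)"

definition admissible :: "'a market \<Rightarrow> 'a history \<Rightarrow> 'a offer \<Rightarrow> bool" where
  "admissible M h d \<longleftrightarrow>
     dom d \<noteq> {} \<and> dom d \<subseteq> agents M - processed h \<and>
     (\<forall>a B. d a = Some B \<longrightarrow> B \<subseteq> opposite M a)"

definition policy :: "'a market \<Rightarrow> 'a policy \<Rightarrow> bool" where
  "policy M \<pi> \<longleftrightarrow>
     (\<forall>h. \<not> agents M \<subseteq> processed h \<longrightarrow> (\<forall>d\<in>set_pmf (\<pi> h). admissible M h d))"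

definition respond :: "'a market \<Rightarrow> 'a offer \<Rightarrow> 'a round pmf" where
  "respond M d =
     Pi_pmf (dom d) None (\<lambda>a. map_pmf (\<lambda>x. Some (the (d a), x)) (choice M a (the (d a))))"

text \<open>
  The first argument of \<open>run\<close> bounds the number of steps. Admissible offers are nonempty, so
  \<^term>\<open>card (agents M)\<close> steps always suffice to process everybody.
\<close>

primrec run :: "nat \<Rightarrow> 'a market \<Rightarrow> 'a policy \<Rightarrow> 'a history \<Rightarrow> 'a history pmf" where
  "run 0 M \<pi> h = return_pmf h"
| "run (Suc k) M \<pi> h =
     (if agents M \<subseteq> processed h then return_pmf h
      else bind_pmf (\<pi> h) (\<lambda>d. bind_pmf (respond M d) (\<lambda>r. run k M \<pi> (h @ [r]))))"

definition chose :: "'a history \<Rightarrow> 'a \<Rightarrow> 'a \<Rightarrow> bool" where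
  "chose h a b \<longleftrightarrow> (\<exists>r\<in>set h. \<exists>B. r a = Some (B, Some b))"

definition num_matches :: "'a market \<Rightarrow> 'a history \<Rightarrow> nat" where
  "num_matches M h = card {(i, j) \<in> customers M \<times> suppliers M. chose h i j \<and> chose h j i}"

definition expected_matches :: "'a market \<Rightarrow> 'a policy \<Rightarrow> real" where
  "expected_matches M \<pi> =
     measure_pmf.expectation (run (card (agents M)) M \<pi> []) (\<lambda>h. real (num_matches M h))"

definition fully_static :: "'a market \<Rightarrow> 'a policy \<Rightarrow> bool" where
  "fully_static M \<pi> \<longleftrightarrow> policy M \<pi> \<and> (\<forall>d\<in>set_pmf (\<pi> []). dom d = agents M)"

definition static_in_order :: "'a market \<Rightarrow> 'a set \<Rightarrow> 'a set \<Rightarrow> 'a policy \<Rightarrow> bool" where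
  "static_in_order M X Y \<pi> \<longleftrightarrow>
     policy M \<pi> \<and>
     (\<forall>d\<in>set_pmf (\<pi> []). dom d = X) \<and>
     (\<forall>r. dom r = X \<longrightarrow> (\<forall>d\<in>set_pmf (\<pi> [r]). dom d = Y))"

definition one_sided_static :: "'a market \<Rightarrow> 'a policy \<Rightarrow> bool" where
  "one_sided_static M \<pi> \<longleftrightarrow>
     static_in_order M (customers M) (suppliers M) \<pi> \<or>
     static_in_order M (suppliers M) (customers M) \<pi>"

text \<open>
  For a market in the sense of \<^const>\<open>market\<close> both suprema range over nonempty sets of reals
  contained in the interval from \<open>0\<close> to the product of the numbers of customers and suppliers,
  and they are attained.
\<close>

definition OPT_FS :: "'a market \<Rightarrow> real" where
  "OPT_FS M = (SUP \<pi>\<in>{\<pi>. fully_static M \<pi>}. expected_matches M \<pi>)"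

definition OPT_OS :: "'a market \<Rightarrow> real" where
  "OPT_OS M = (SUP \<pi>\<in>{\<pi>. one_sided_static M \<pi>}. expected_matches M \<pi>)"

end

theory Submission
  imports Defs
begin

text \<open>
  Take \<open>n\<close> customers and \<open>n\<close> suppliers. A customer draws one of the suppliers uniformly at
  random, before looking at the assortment, and chooses it if it is offered and nothing otherwise.
  A supplier deterministically chooses the smallest customer it is shown. The demand of a customer
  is \<open>|B| / n\<close>, that of a supplier is the indicator of \<open>B \<noteq> {}\<close>; both are monotone and
  submodular.

  In a fully static policy each supplier is committed in advance to one customer, who chooses it
  with probability at most \<open>1 / n\<close>. Summing over the \<open>n\<close> suppliers gives at most one match on
  average (\<open>OPT_FS_decisive_le\<close>). If instead the customers move first and see everybody, and each
  supplier is then shown exactly the customers who chose it, every supplier chosen by somebody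
  is matched. Hence the matches number as many as the nonempty bins when \<open>n\<close> balls are
  thrown into \<open>n\<close> bins, which is \<open>n (1 - (1 - 1/n)^n) \<ge> n (1 - 1/e) \<ge> n / 2\<close> on average
  (\<open>OPT_OS_decisive_ge\<close>). So \<open>c = 1/2\<close> works.
\<close>

section \<open>Expectations under a probability mass function\<close>

lemma integrable_bounded_pmf:
  fixes f :: "'a \<Rightarrow> real"
  assumes "\<And>x. x \<in> set_pmf p \<Longrightarrow> 0 \<le> f x" and "\<And>x. x \<in> set_pmf p \<Longrightarrow> f x \<le> b"
  shows "integrable (measure_pmf p) f"
  using assms by (intro measure_pmf.integrable_const_bound[where B = b]) (auto simp: AE_measure_pmf_iff)

text \<open>
  Randomizing over offers cannot beat a bound that holds for each single offer. The proof passes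
  to nonnegative integrals, where the integral over a bind is an iterated integral.
\<close>

lemma expectation_bind_pmf_le:
  fixes f :: "'b \<Rightarrow> real"
  assumes nonneg: "\<And>y. 0 \<le> f y" and bound: "\<And>y. f y \<le> b" and "0 \<le> k"
    and inner: "\<And>x. x \<in> set_pmf p \<Longrightarrow> measure_pmf.expectation (q x) f \<le> k"
  shows "measure_pmf.expectation (bind_pmf p q) f \<le> k"
proof -
  have nn: "(\<integral>\<^sup>+ y. ennreal (f y) \<partial>measure_pmf r) = ennreal (measure_pmf.expectation r f)" for r
    using nonneg bound by (intro nn_integral_eq_integral integrable_bounded_pmf) auto
  have "ennreal (measure_pmf.expectation (bind_pmf p q) f)
      = (\<integral>\<^sup>+ x. ennreal (measure_pmf.expectation (q x) f) \<partial>measure_pmf p)"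
    by (simp flip: nn)
  also have "\<dots> \<le> (\<integral>\<^sup>+ x. ennreal k \<partial>measure_pmf p)"
    using inner by (intro nn_integral_mono_AE) (auto simp: AE_measure_pmf_iff ennreal_leI)
  also have "\<dots> = ennreal k"
    by simp
  finally show ?thesis
    using \<open>0 \<le> k\<close> by simp
qed

lemma integrable_card_filter:
  assumes "finite S"
  shows "integrable (measure_pmf p) (\<lambda>x. real (card {j \<in> S. P j x}))"
  using assms by (intro integrable_bounded_pmf[where b = "real (card S)"]) (auto intro: card_mono)

lemma expectation_card_filter:
  assumes "finite S"
  shows "measure_pmf.expectation p (\<lambda>x. real (card {j \<in> S. P j x}))
    = (\<Sum>j\<in>S. measure_pmf.prob p {x. P j x})"
proof -
  have "real (card {j \<in> S. P j x}) = (\<Sum>j\<in>S. indicator {x. P j x} x)" for x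
    using assms by (simp add: indicator_def sum.If_cases Int_def)
  then show ?thesis
    by (simp add: measure_pmf.emeasure_eq_measure)
qed

section \<open>Matches and responses in a general market\<close>

lemma finite_agents: "market M \<Longrightarrow> finite (agents M)"
  by (simp add: market_def agents_def)

lemma num_matches_le:
  assumes "market M"
  shows "num_matches M h \<le> card (customers M) * card (suppliers M)"
  using assms unfolding num_matches_def market_def
  by (subst card_cartesian_product[symmetric]) (intro card_mono, auto)

lemma integrable_num_matches:
  "market M \<Longrightarrow> integrable (measure_pmf p) (\<lambda>x. real (num_matches M (h x)))"
  by (rule integrable_bounded_pmf[where b = "real (card (customers M) * card (suppliers M))"])
     (simp_all add: num_matches_le del: of_nat_mult)

lemma bdd_above_expected_matches:
  assumes "market M"
  shows "bdd_above (expected_matches M ` P)"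
proof (rule bdd_aboveI2)
  fix \<pi>
  show "expected_matches M \<pi> \<le> real (card (customers M) * card (suppliers M))"
    unfolding expected_matches_def
    using assms by (intro measure_pmf.integral_le_const integrable_num_matches)
      (simp_all add: num_matches_le del: of_nat_mult)
qed

lemma set_respond:
  assumes "finite (dom d)" and "r \<in> set_pmf (respond M d)"
  shows "dom r = dom d"
    and "a \<in> dom d \<Longrightarrow> \<exists>x\<in>set_pmf (choice M a (the (d a))). r a = Some (the (d a), x)"
proof -
  have r: "(a \<notin> dom d \<longrightarrow> r a = None) \<and>
      (a \<in> dom d \<longrightarrow> (\<exists>x\<in>set_pmf (choice M a (the (d a))). r a = Some (the (d a), x)))" for a
    using assms by (auto simp: respond_def set_Pi_pmf PiE_dflt_def)
  then show "a \<in> dom d \<Longrightarrow> \<exists>x\<in>set_pmf (choice M a (the (d a))). r a = Some (the (d a), x)"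
    by blast
  show "dom r = dom d"
    using r by (metis (no_types, lifting) domIff option.simps(3) subsetI subset_antisym)
qed

lemma chose_Nil [simp]: "\<not> chose [] a b"
  by (simp add: chose_def)

lemma chose_Cons: "chose (r # h) a b \<longleftrightarrow> (\<exists>B. r a = Some (B, Some b)) \<or> chose h a b"
  by (auto simp: chose_def)

lemma prob_chose:
  assumes "finite (dom d)" and "a \<in> dom d"
  shows "measure_pmf.prob (respond M d) {r. chose [r] a b}
    = pmf (choice M a (the (d a))) (Some b)"
proof -
  let ?c = "choice M a (the (d a))"
  have "measure_pmf.prob (respond M d) {r. chose [r] a b}
      = measure_pmf.prob (map_pmf (\<lambda>r. r a) (respond M d)) {y. \<exists>B. y = Some (B, Some b)}"
    by (simp add: vimage_def chose_Cons)
  also have "map_pmf (\<lambda>r. r a) (respond M d) = map_pmf (\<lambda>x. Some (the (d a), x)) ?c"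
    using assms by (simp add: respond_def Pi_pmf_component)
  also have "measure_pmf.prob \<dots> {y. \<exists>B. y = Some (B, Some b)} = measure_pmf.prob ?c {Some b}"
    by (simp add: vimage_def)
  finally show ?thesis
    by (simp add: measure_pmf_single)
qed

text \<open>The agents of one step respond independently, so their probabilities of not choosing
  \<open>b\<close> multiply.\<close>

lemma prob_nobody_chose:
  assumes "finite (dom d)"
  shows "measure_pmf.prob (respond M d) {r. \<forall>a\<in>dom d. \<not> chose [r] a b}
    = (\<Prod>a\<in>dom d. 1 - pmf (choice M a (the (d a))) (Some b))"
proof -
  have "{r. \<forall>a\<in>dom d. \<not> chose [r] a b} = Pi (dom d) (\<lambda>_. {y. \<nexists>B. y = Some (B, Some b)})"
    by (auto simp: chose_Cons Pi_def)
  then have "measure_pmf.prob (respond M d) {r. \<forall>a\<in>dom d. \<not> chose [r] a b}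
      = (\<Prod>a\<in>dom d. measure_pmf.prob (choice M a (the (d a))) (UNIV - {Some b}))"
    using assms unfolding respond_def
    by (simp add: measure_Pi_pmf_Pi vimage_def) (simp add: set_diff_eq)
  also have "\<dots> = (\<Prod>a\<in>dom d. 1 - pmf (choice M a (the (d a))) (Some b))"
    by (simp add: measure_pmf.prob_compl[simplified] measure_pmf_single)
  finally show ?thesis .
qed

text \<open>Both sides are nonempty, so the step bound of \<^const>\<open>run\<close> leaves room for two rounds.\<close>

lemma card_agents_market:
  assumes "market M"
  obtains k where "card (agents M) = Suc (Suc k)"
proof -
  have "card (agents M) = card (customers M) + card (suppliers M)"
    using assms by (simp add: market_def agents_def card_Un_disjoint)
  moreover have "card (customers M) > 0" "card (suppliers M) > 0"
    using assms by (simp_all add: market_def card_gt_0_iff)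
  ultimately show ?thesis
    using that[of "card (agents M) - 2"] by linarith
qed

lemma fully_static_offer:
  assumes "market M" and "fully_static M \<pi>" and "d \<in> set_pmf (\<pi> [])"
  shows "dom d = agents M" and "d a = Some B \<Longrightarrow> B \<subseteq> opposite M a"
proof -
  have "\<not> agents M \<subseteq> processed []"
    using assms(1) by (simp add: market_def agents_def processed_def)
  then have "admissible M [] d"
    using assms by (simp add: fully_static_def policy_def)
  then show "d a = Some B \<Longrightarrow> B \<subseteq> opposite M a"
    by (simp add: admissible_def)
  show "dom d = agents M"
    using assms by (simp add: fully_static_def)
qed

lemma run_fully_static:
  assumes "market M" and "fully_static M \<pi>"
  shows "run (card (agents M)) M \<pi> [] = bind_pmf (\<pi> []) (\<lambda>d. map_pmf (\<lambda>r. [r]) (respond M d))"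
proof -
  obtain k where k: "card (agents M) = Suc (Suc k)"
    using assms(1) by (rule card_agents_market)
  have one: "run (Suc k) M \<pi> [r] = return_pmf [r]"
    if "d \<in> set_pmf (\<pi> [])" "r \<in> set_pmf (respond M d)" for d r
    using that set_respond(1)[of d r M] assms finite_agents[OF assms(1)]
    by (simp add: fully_static_def processed_def)
  have "agents M \<noteq> {}"
    using assms(1) by (simp add: market_def agents_def)
  then show ?thesis
    using one unfolding k
    by (auto simp: processed_def map_pmf_def simp del: run.simps(2) simp add: run.simps(2)[of "Suc k"]
        intro!: bind_pmf_cong)
qed

section \<open>Showing everything, and showing the proposers\<close>

definition show_everything :: "'a market \<Rightarrow> 'a policy" where
  "show_everything M h =
     return_pmf (\<lambda>a. if a \<in> agents M - processed h then Some (opposite M a) else None)"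

lemma dom_if_Some: "dom (\<lambda>a. if P a then Some (f a) else None) = {a. P a}"
  by (auto split: if_splits)

lemma fully_static_show_everything: "fully_static M (show_everything M)"
  by (auto simp: fully_static_def policy_def admissible_def show_everything_def processed_def
      dom_if_Some split: if_splits)

definition full_customer_offer :: "'a market \<Rightarrow> 'a offer" where
  "full_customer_offer M = (\<lambda>a. if a \<in> customers M then Some (suppliers M) else None)"

lemma dom_full_customer_offer [simp]: "dom (full_customer_offer M) = customers M"
  by (simp add: full_customer_offer_def dom_if_Some)

definition proposers_offer :: "'a market \<Rightarrow> 'a round \<Rightarrow> 'a offer" where
  "proposers_offer M r =
     (\<lambda>a. if a \<in> suppliers M then Some {b \<in> customers M. chose [r] b a} else None)"

lemma dom_proposers_offer [simp]: "dom (proposers_offer M r) = suppliers M"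
  by (simp add: proposers_offer_def dom_if_Some)

text \<open>
  The customers see all suppliers, then each supplier sees the customers who chose it. A policy
  must make an admissible offer after every history, so the second clause is phrased for
  arbitrary histories; on those that occur it is \<^const>\<open>proposers_offer\<close>.
\<close>

definition show_proposers :: "'a market \<Rightarrow> 'a policy" where
  "show_proposers M h = return_pmf
     (if h = [] then full_customer_offer M
      else (\<lambda>a. if a \<in> agents M - processed h then Some {b \<in> opposite M a. chose h b a} else None))"

lemma show_proposers_Nil: "show_proposers M [] = return_pmf (full_customer_offer M)"
  by (simp add: show_proposers_def)

lemma one_sided_static_show_proposers:
  assumes "market M"
  shows "one_sided_static M (show_proposers M)"
proof -
  have "policy M (show_proposers M)"
    using assms
    by (auto simp: policy_def admissible_def show_proposers_def full_customer_offer_def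
        processed_def dom_if_Some agents_def market_def opposite_def
        simp del: dom_eq_empty_conv split: if_splits)
  moreover have "agents M - customers M = suppliers M"
    using assms by (auto simp: agents_def market_def)
  ultimately show ?thesis
    by (auto simp: one_sided_static_def static_in_order_def show_proposers_def dom_if_Some
        processed_def split: if_splits)
qed

lemma run_show_proposers:
  assumes M: "market M"
  shows "run (card (agents M)) M (show_proposers M) []
    = bind_pmf (respond M (full_customer_offer M)) (\<lambda>r.
        map_pmf (\<lambda>r'. [r, r']) (respond M (proposers_offer M r)))"
    (is "_ = bind_pmf ?p _")
proof -
  obtain k where k: "card (agents M) = Suc (Suc k)"
    using M by (rule card_agents_market)
  have fin: "finite (customers M)" "finite (suppliers M)"
    and ne: "agents M \<noteq> {}" and sub: "\<not> agents M \<subseteq> customers M"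
    and diff: "agents M - customers M = suppliers M"
    using M by (auto simp: market_def agents_def)
  have two: "run k M (show_proposers M) [r, r'] = return_pmf [r, r']"
    if "r \<in> set_pmf ?p" "r' \<in> set_pmf (respond M (proposers_offer M r))" for r r'
  proof -
    have "dom r = customers M" "dom r' = suppliers M"
      using set_respond(1)[OF _ that(1)] set_respond(1)[OF _ that(2)] fin
      by (simp_all add: dom_if_Some)
    then show ?thesis
      by (cases k) (simp_all add: processed_def agents_def)
  qed
  have one: "run (Suc k) M (show_proposers M) [r]
      = map_pmf (\<lambda>r'. [r, r']) (respond M (proposers_offer M r))"
    if r: "r \<in> set_pmf ?p" for r
  proof -
    have "dom r = customers M"
      using set_respond(1)[OF _ r] fin by simp
    then have "show_proposers M [r]
        = return_pmf (\<lambda>a. if a \<in> suppliers M then Some {b \<in> opposite M a. chose [r] b a} else None)"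
      by (simp add: show_proposers_def processed_def diff del: Diff_iff)
    also have "\<dots> = return_pmf (proposers_offer M r)"
      using M by (auto simp: proposers_offer_def opposite_def market_def fun_eq_iff
          intro!: arg_cong[where f = return_pmf])
    finally show ?thesis
      using two[OF r] \<open>dom r = customers M\<close> sub
      by (auto simp: processed_def bind_return_pmf map_pmf_def intro!: bind_pmf_cong)
  qed
  show ?thesis
    unfolding k run.simps(2)[of "Suc k"] using ne
    by (simp add: processed_def bind_return_pmf show_proposers_Nil one cong: bind_pmf_cong
        del: run.simps(2))
qed

section \<open>A market of random customers and decisive suppliers\<close>

definition decisive_market :: "nat \<Rightarrow> nat market" where
  "decisive_market n =
     \<lparr> customers = {..<n}, suppliers = {n..<2 * n},
       choice = (\<lambda>a B.
         if a < n then map_pmf (\<lambda>j. if j \<in> B then Some j else None) (pmf_of_set {n..<2 * n})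
         else return_pmf (if B = {} then None else Some (Min B))) \<rparr>"

context
  fixes n :: nat
  assumes n: "n \<ge> 1"
begin

private abbreviation "M \<equiv> decisive_market n"

lemma decisive_market_simps [simp]:
  "customers M = {..<n}" "suppliers M = {n..<2 * n}" "agents M = {..<2 * n}"
  "opposite M a = (if a < n then {n..<2 * n} else {..<n})"
  "\<not> a < n \<Longrightarrow> choice M a B = return_pmf (if B = {} then None else Some (Min B))"
  by (auto simp: decisive_market_def agents_def opposite_def)

lemma set_pmf_customer:
  "a < n \<Longrightarrow> set_pmf (choice M a B) = (\<lambda>j. if j \<in> B then Some j else None) ` {n..<2 * n}"
  using n by (simp add: decisive_market_def)

lemma pmf_customer:
  assumes "a < n"
  shows "pmf (choice M a B) (Some j) = (if j \<in> B \<inter> {n..<2 * n} then 1 / real n else 0)"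
proof -
  have "(\<lambda>i. if i \<in> B then Some i else None) -` {Some j} = (if j \<in> B then {j} else {})"
    by (auto split: if_splits)
  then have "pmf (choice M a B) (Some j)
      = measure_pmf.prob (pmf_of_set {n..<2 * n}) (if j \<in> B then {j} else {})"
    using assms by (simp add: decisive_market_def pmf_map)
  then show ?thesis
    using n by (auto simp: measure_pmf_single)
qed

lemma market_decisive: "market M"
  unfolding market_def
proof (intro conjI ballI allI impI)
  fix a B assume "a \<in> agents M" and B: "B \<subseteq> opposite M a"
  show "set_pmf (choice M a B) \<subseteq> insert None (Some ` B)"
  proof (cases "a < n")
    case True
    then show ?thesis by (auto simp: set_pmf_customer)
  next
    case False
    then have "finite B" using B by (auto intro: finite_subset)
    with False show ?thesis by auto
  qed
qed (use n in \<open>auto simp: lessThan_empty_iff\<close>)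

lemma demand_customer:
  assumes "a < n" and "B \<subseteq> {n..<2 * n}"
  shows "demand M a B = real (card B) / real n"
proof -
  have "demand M a B = (\<Sum>j\<in>B. 1 / real n)"
    using assms unfolding demand_def by (intro sum.cong) (auto simp: pmf_customer)
  then show ?thesis by simp
qed

lemma demand_supplier:
  assumes "\<not> a < n" and "B \<subseteq> {..<n}"
  shows "demand M a B = (if B = {} then 0 else 1)"
proof -
  have "finite B" using assms(2) by (rule finite_subset) simp
  then show ?thesis
    using assms(1) by (simp add: demand_def pmf_return indicator_def)
qed

lemma monotone_submodular_decisive: "monotone_submodular_demands M"
  unfolding monotone_submodular_demands_def
proof (intro ballI conjI)
  fix a
  have fin: "finite B" if "B \<subseteq> {n..<2 * n}" for B
    using that by (rule finite_subset) simp
  show "mono_on (Pow (opposite M a)) (demand M a)"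
  proof (cases "a < n")
    case True
    then show ?thesis
      using n by (auto intro!: mono_onI divide_right_mono card_mono simp: demand_customer fin)
  next
    case False
    then show ?thesis by (auto intro!: mono_onI simp: demand_supplier)
  qed
  show "submodular_on (opposite M a) (demand M a)"
    unfolding submodular_on_def
  proof (intro allI impI)
    fix X Y assume X: "X \<subseteq> opposite M a" and Y: "Y \<subseteq> opposite M a"
    show "demand M a (X \<union> Y) + demand M a (X \<inter> Y) \<le> demand M a X + demand M a Y"
    proof (cases "a < n")
      case True
      with X Y have XY: "X \<subseteq> {n..<2 * n}" "Y \<subseteq> {n..<2 * n}" by auto
      then have "card (X \<union> Y) + card (X \<inter> Y) = card X + card Y"
        using card_Un_Int[of X Y] fin by simp
      then have "real (card (X \<union> Y)) + real (card (X \<inter> Y)) = real (card X) + real (card Y)"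
        by (metis of_nat_add)
      moreover have "X \<union> Y \<subseteq> {n..<2 * n}" "X \<inter> Y \<subseteq> {n..<2 * n}"
        using XY by auto
      ultimately show ?thesis
        using True XY by (simp add: demand_customer flip: add_divide_distrib)
    next
      case False
      with X Y have "X \<subseteq> {..<n}" "Y \<subseteq> {..<n}" "X \<union> Y \<subseteq> {..<n}" "X \<inter> Y \<subseteq> {..<n}" by auto
      with False show ?thesis
        by (simp add: demand_supplier)
    qed
  qed
qed

section \<open>Fully static policies\<close>

text \<open>
  A supplier \<open>j\<close> that is shown a nonempty assortment chooses its minimum, \<open>fav j\<close>, with
  certainty, so \<open>j\<close> is matched only if \<open>fav j\<close> happens to choose \<open>j\<close>. The expected number of
  such \<open>j\<close> is a sum of at most \<open>n\<close> probabilities, each at most \<open>1 / n\<close>.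
\<close>

lemma respond_fully_static_le:
  assumes dom: "dom d = {..<2 * n}" and sub: "\<And>a B. d a = Some B \<Longrightarrow> B \<subseteq> opposite M a"
  shows "measure_pmf.expectation (respond M d) (\<lambda>r. real (num_matches M [r])) \<le> 1"
proof -
  define fav where "fav j = Min (the (d j))" for j
  define T where "T = {j \<in> {n..<2 * n}. the (d j) \<noteq> {}}"
  have fav: "fav j < n" if "j \<in> T" for j
  proof -
    have "j \<in> dom d" using that dom by (simp add: T_def)
    then obtain B where B: "d j = Some B" by blast
    then have "B \<subseteq> {..<n}" "B \<noteq> {}"
      using sub[OF B] that by (auto simp: T_def)
    moreover from this have "finite B" using finite_subset by blast
    ultimately have "Min B \<in> {..<n}" by (meson Min_in subsetD)
    then show ?thesis by (simp add: fav_def B)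
  qed
  have "num_matches M [r] \<le> card {j \<in> T. chose [r] (fav j) j}" if r: "r \<in> set_pmf (respond M d)" for r
  proof -
    have "{(i, j) \<in> customers M \<times> suppliers M. chose [r] i j \<and> chose [r] j i}
        \<subseteq> (\<lambda>j. (fav j, j)) ` {j \<in> T. chose [r] (fav j) j}"
    proof safe
      fix i j assume ij: "i \<in> customers M" "j \<in> suppliers M" and "chose [r] i j" "chose [r] j i"
      have "j \<in> dom d" using ij dom by simp
      then obtain x where "x \<in> set_pmf (choice M j (the (d j)))" "r j = Some (the (d j), x)"
        using set_respond(2)[OF _ r, of j] dom by auto
      with \<open>chose [r] j i\<close> ij have "j \<in> T" "i = fav j"
        by (auto simp: chose_Cons T_def fav_def split: if_splits)
      with \<open>chose [r] i j\<close> show "(i, j) \<in> (\<lambda>j. (fav j, j)) ` {j \<in> T. chose [r] (fav j) j}"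
        by auto
    qed
    then show ?thesis
      unfolding num_matches_def by (rule surj_card_le[rotated]) (simp add: T_def)
  qed
  then have "measure_pmf.expectation (respond M d) (\<lambda>r. real (num_matches M [r]))
      \<le> measure_pmf.expectation (respond M d) (\<lambda>r. real (card {j \<in> T. chose [r] (fav j) j}))"
    by (intro integral_mono_AE integrable_num_matches integrable_card_filter market_decisive)
       (simp_all add: AE_measure_pmf_iff T_def)
  also have "\<dots> = (\<Sum>j\<in>T. measure_pmf.prob (respond M d) {r. chose [r] (fav j) j})"
    by (rule expectation_card_filter) (simp add: T_def)
  also have "\<dots> \<le> (\<Sum>j\<in>T. 1 / real n)"
  proof (rule sum_mono)
    fix j assume "j \<in> T"
    with fav have "fav j < n" .
    then show "measure_pmf.prob (respond M d) {r. chose [r] (fav j) j} \<le> 1 / real n"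
      using dom by (simp add: prob_chose pmf_customer)
  qed
  also have "\<dots> \<le> 1"
  proof -
    have "card T \<le> card {n..<2 * n}" unfolding T_def by (intro card_mono) auto
    then show ?thesis using n by simp
  qed
  finally show ?thesis .
qed

lemma OPT_FS_decisive_le: "OPT_FS M \<le> 1"
  unfolding OPT_FS_def
proof (rule cSUP_least)
  show "{\<pi>. fully_static M \<pi>} \<noteq> {}"
    using fully_static_show_everything by blast
next
  fix \<pi> assume "\<pi> \<in> {\<pi>. fully_static M \<pi>}"
  then have \<pi>: "fully_static M \<pi>" by simp
  show "expected_matches M \<pi> \<le> 1"
    unfolding expected_matches_def run_fully_static[OF market_decisive \<pi>]
  proof (rule expectation_bind_pmf_le)
    show "real (num_matches M h) \<le> real (n * n)" for h
      using num_matches_le[OF market_decisive, of h] by (simp del: of_nat_mult)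
  next
    fix d assume "d \<in> set_pmf (\<pi> [])"
    then show "measure_pmf.expectation (map_pmf (\<lambda>r. [r]) (respond M d))
        (\<lambda>h. real (num_matches M h)) \<le> 1"
      using respond_fully_static_le fully_static_offer[OF market_decisive \<pi>]
      by (simp del: decisive_market_simps(4))
  qed simp_all
qed

text \<open>
  When everybody sees everybody, all suppliers choose customer \<open>0\<close>, who certainly chooses some
  supplier.
\<close>

lemma OPT_FS_decisive_pos: "OPT_FS M > 0"
proof -
  let ?\<pi> = "show_everything M"
  have "1 \<le> num_matches M h" if h: "h \<in> set_pmf (run (card (agents M)) M ?\<pi> [])" for h
  proof -
    let ?d = "\<lambda>a. if a \<in> agents M then Some (opposite M a) else None"
    have dom: "dom ?d = {..<2 * n}" by (auto split: if_splits)
    obtain r where r: "h = [r]" "r \<in> set_pmf (respond M ?d)"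
      using h unfolding run_fully_static[OF market_decisive fully_static_show_everything]
      by (auto simp: show_everything_def processed_def bind_return_pmf simp del: decisive_market_simps)
    have resp: "\<exists>x\<in>set_pmf (choice M a (opposite M a)). r a = Some (opposite M a, x)"
      if "a < 2 * n" for a
      using set_respond(2)[OF _ r(2), of a] dom that by simp
    obtain j where j: "j \<in> {n..<2 * n}" "chose [r] 0 j"
      using resp[of 0] n by (auto simp: set_pmf_customer chose_Cons)
    moreover have "Min {..<n} = 0"
      using n by (intro Min_eqI) auto
    then have "chose [r] j 0"
      using resp[of j] j(1) n by (auto simp: chose_Cons lessThan_empty_iff)
    ultimately have "{(0, j)} \<subseteq> {(i, j) \<in> customers M \<times> suppliers M. chose h i j \<and> chose h j i}"
      using n r(1) by auto
    then have "card {(0 :: nat, j)} \<le> num_matches M h"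
      unfolding num_matches_def
      by (rule card_mono[rotated]) (rule finite_subset[of _ "{..<n} \<times> {n..<2 * n}"], auto)
    then show ?thesis by simp
  qed
  then have "1 \<le> expected_matches M ?\<pi>"
    unfolding expected_matches_def
    by (intro measure_pmf.integral_ge_const integrable_num_matches market_decisive)
       (auto simp: AE_measure_pmf_iff)
  also have "\<dots> \<le> OPT_FS M"
    unfolding OPT_FS_def using fully_static_show_everything
    by (intro cSUP_upper bdd_above_expected_matches market_decisive) simp
  finally show ?thesis by simp
qed

section \<open>Customers first\<close>

text \<open>
  A supplier in \<open>?hit r\<close>, that is, one chosen by somebody in the first round \<open>r\<close>, is shown a
  nonempty set of customers who all chose it, so whichever of them it takes, a match results.
  A given supplier is missed by all \<open>n\<close> independent customers with probability
  \<open>(1 - 1/n)^n\<close>.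
\<close>

lemma OPT_OS_decisive_ge: "real n * (1 - (1 - 1 / real n) ^ n) \<le> OPT_OS M"
proof -
  let ?\<pi> = "show_proposers M" and ?d = "full_customer_offer M"
  let ?run = "run (card (agents M)) M ?\<pi> []"
  let ?hit = "\<lambda>r. {j \<in> {n..<2 * n}. \<exists>i\<in>{..<n}. chose [r] i j}"
  \<comment> \<open>The size of \<open>?hit\<close> depends on the first round only, whose law is a single response.\<close>
  have hd: "map_pmf hd ?run = respond M ?d"
    unfolding run_show_proposers[OF market_decisive]
    by (simp add: map_bind_pmf map_pmf_comp map_pmf_const bind_return_pmf')
  have le: "card (?hit (hd h)) \<le> num_matches M h" if h_run: "h \<in> set_pmf ?run" for h
  proof -
    obtain r r' where h: "h = [r, r']" and r': "r' \<in> set_pmf (respond M (proposers_offer M r))"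
      using h_run unfolding run_show_proposers[OF market_decisive]
      by (auto simp del: decisive_market_simps)
    have "?hit r \<subseteq> snd ` {(i, j) \<in> customers M \<times> suppliers M. chose h i j \<and> chose h j i}"
    proof
      fix j assume "j \<in> ?hit r"
      then have j: "j \<in> {n..<2 * n}" and ne: "{b \<in> {..<n}. chose [r] b j} \<noteq> {}" by auto
      define i where "i = Min {b \<in> {..<n}. chose [r] b j}"
      have "i \<in> {b \<in> {..<n}. chose [r] b j}"
        unfolding i_def using ne by (intro Min_in) auto
      then have i: "i < n" "chose [r] i j" by auto
      have "the (proposers_offer M r j) = {b \<in> {..<n}. chose [r] b j}"
        using j by (simp add: proposers_offer_def)
      moreover have "\<exists>x\<in>set_pmf (choice M j (the (proposers_offer M r j))).
          r' j = Some (the (proposers_offer M r j), x)"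
        using j by (intro set_respond(2)[OF _ r']) simp_all
      ultimately have "chose [r'] j i"
        using j ne by (simp add: chose_Cons i_def)
      with i j show "j \<in> snd ` {(i, j) \<in> customers M \<times> suppliers M. chose h i j \<and> chose h j i}"
        by (force simp: h chose_Cons)
    qed
    then show ?thesis
      unfolding num_matches_def h list.sel
      by (rule surj_card_le[rotated]) (rule finite_subset[of _ "{..<n} \<times> {n..<2 * n}"], auto)
  qed
  have "real n * (1 - (1 - 1 / real n) ^ n)
      = (\<Sum>j\<in>{n..<2 * n}. measure_pmf.prob (respond M ?d) {r. \<exists>i\<in>{..<n}. chose [r] i j})"
  proof -
    have "measure_pmf.prob (respond M ?d) {r. \<exists>i\<in>{..<n}. chose [r] i j} = 1 - (1 - 1 / real n) ^ n"
      if "j \<in> {n..<2 * n}" for j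
    proof -
      have "{r. \<exists>i\<in>{..<n}. chose [r] i j} = UNIV - {r. \<forall>i\<in>dom ?d. \<not> chose [r] i j}"
        by auto
      then have "measure_pmf.prob (respond M ?d) {r. \<exists>i\<in>{..<n}. chose [r] i j}
          = 1 - (\<Prod>i<n. 1 - pmf (choice M i (the (?d i))) (Some j))"
        by (simp only: measure_pmf.prob_compl[simplified] prob_nobody_chose[of ?d] dom_full_customer_offer
            decisive_market_simps finite_lessThan sets_measure_pmf UNIV_I)
           (simp add: prob_nobody_chose[of ?d, simplified])
      also have "(\<Prod>i<n. 1 - pmf (choice M i (the (?d i))) (Some j)) = (\<Prod>i<n. 1 - 1 / real n)"
        using that by (intro prod.cong) (auto simp: full_customer_offer_def pmf_customer)
      finally show ?thesis by simp
    qed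
    then show ?thesis by simp
  qed
  also have "\<dots> = measure_pmf.expectation (map_pmf hd ?run) (\<lambda>r. real (card (?hit r)))"
    unfolding hd by (rule expectation_card_filter[symmetric]) simp
  also have "\<dots> \<le> expected_matches M ?\<pi>"
    unfolding expected_matches_def integral_map_pmf
  proof (rule integral_mono_AE)
    show "integrable ?run (\<lambda>h. real (card (?hit (hd h))))"
      by (rule integrable_card_filter) simp
    show "integrable ?run (\<lambda>h. real (num_matches M h))"
      by (rule integrable_num_matches[OF market_decisive])
    show "AE h in ?run. real (card (?hit (hd h))) \<le> real (num_matches M h)"
      using le unfolding AE_measure_pmf_iff of_nat_le_iff by blast
  qed
  also have "\<dots> \<le> OPT_OS M"
    unfolding OPT_OS_def using one_sided_static_show_proposers[OF market_decisive]
    by (intro cSUP_upper bdd_above_expected_matches market_decisive) simp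
  finally show ?thesis .
qed

end

theorem proposition3p1:
  "\<exists>c::real. c > 0 \<and>
     (\<forall>n::nat. n \<ge> 1 \<longrightarrow>
        (\<exists>M::nat market.
           market M \<and> card (customers M) = n \<and> monotone_submodular_demands M \<and>
           OPT_FS M > 0 \<and> OPT_OS M \<ge> c * real n * OPT_FS M))"
proof (intro exI[of _ "1 / 2"] conjI allI impI)
  fix n :: nat assume n: "n \<ge> 1"
  let ?M = "decisive_market n"
  have "(1 - 1 / real n) ^ n \<le> exp (- 1)"
    using n by (intro exp_ge_one_minus_x_over_n_power_n) auto
  also have "\<dots> \<le> 1 / 2"
    using exp_ge_add_one_self[of 1] by (simp add: exp_minus field_simps)
  finally have "real n * (1 / 2) \<le> real n * (1 - (1 - 1 / real n) ^ n)"
    by (intro mult_left_mono) auto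
  also have "\<dots> \<le> OPT_OS ?M"
    using n by (rule OPT_OS_decisive_ge)
  finally have "1 / 2 * real n \<le> OPT_OS ?M" by simp
  moreover have "1 / 2 * real n * OPT_FS ?M \<le> 1 / 2 * real n * 1"
    using OPT_FS_decisive_le[OF n] by (intro mult_left_mono) auto
  ultimately have "OPT_OS ?M \<ge> 1 / 2 * real n * OPT_FS ?M" by linarith
  then show "\<exists>M::nat market. market M \<and> card (customers M) = n \<and>
      monotone_submodular_demands M \<and> OPT_FS M > 0 \<and> OPT_OS M \<ge> 1 / 2 * real n * OPT_FS M"
    using n market_decisive monotone_submodular_decisive OPT_FS_decisive_pos
    by (intro exI[of _ ?M]) simp
qed simp

end
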